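(* Suppose $W\subseteq\mathbb{C}$ is a star-like domain with center $0$. If $f$ is an analytic function on $W$ such that $\limsup_{z\to\partial W}|f(z)|\le K<\infty$, and $|f(z)|\le Ce^{C|z|^{2p}}+C$ for all $z\in W$, for some $C>0$ and some $p>0$ with $p<\frac{\pi}{2\mathcal{A}_W}$, then $|f(z)|\le K$ for all $z\in W$.
   Context: A domain is a nonempty connected open subset of $\mathbb{C}$. A domain $W$ is star-like with center $a$ if for every $z\in W$ the line segment $\{a+s(z-a): 0<s\le 1\}$ connecting $a$ to $z$ lies within $W$ (the center itself is not required to belong to $W$). For $r>0$ let $\mathcal{A}_{r,W}=\max\{m(E): E \text{ is a subarc of } W\cap\{|z|=r\}\}$, where $m$ denotes angular Lebesgue measure on the circle $\{|z|=r\}$ (so the full circle has measure $2\pi$, and $\mathcal{A}_{r,W}=0$ if $W\cap\{|z|=r\}=\emptyset$). For $W$ star-like with center $0$, $\mathcal{A}_{r,W}$ is nonincreasing in $r$, and $\mathcal{A}_W=\lim_{r\to\infty}\mathcal{A}_{r,W}$; if $\mathcal{A}_W=0$, the quantity $\frac{\pi}{2\mathcal{A}_W}$ is read as $+\infty$. $\partial W$ denotes the boundary of $W$ in $\mathbb{C}$ (the point at $\infty$ is not included). The condition $\limsup_{z\to\partial W}|f(z)|\le K$ means that $\limsup_{z\to\zeta,\, z\in W}|f(z)|\le K$ for every $\zeta\in\partial W$.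
   Formalization: W is additionally assumed to be neither ℂ nor ℂ∖{0}; the claim fails there: on ℂ the boundary is empty (f = 2, K = 1, p = 1/8), and on ℂ∖{0} take f(z) = z, K = 1, p = 1/8. *)

theory Defs
  imports "HOL-Complex_Analysis.Complex_Analysis"
begin

definition domain :: "complex set \<Rightarrow> bool" where
  "domain W \<longleftrightarrow> open W \<and> connected W \<and> W \<noteq> {}"

(* The library's starlike demands that the center lie in the set; here s = 0 is excluded,
   so the center need not belong to W. *)
definition star_like_with_center :: "complex \<Rightarrow> complex set \<Rightarrow> bool" where
  "star_like_with_center a W \<longleftrightarrow>
     (\<forall>z\<in>W. (\<lambda>s. a + complex_of_real s * (z - a)) ` {0<..1} \<subseteq> W)"

(* Angular Lebesgue measure on the circle of radius r: the full circle has measure 2 * pi. *)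
definition angular_measure :: "real \<Rightarrow> complex set \<Rightarrow> real" where
  "angular_measure r E = measure lebesgue {t \<in> {0..<2 * pi}. rcis r t \<in> E}"

(* Open, half-open and closed arcs, the full circle, single points and the empty set. *)
definition circle_arc :: "real \<Rightarrow> complex set \<Rightarrow> bool" where
  "circle_arc r E \<longleftrightarrow> (\<exists>I::real set. is_interval I \<and> E = rcis r ` I)"

(* For r > 0 and open W the supremum is a maximum. The empty arc is always among the E, so the
   value is 0 if W does not meet the circle; all values are at most 2 * pi. *)
definition max_arc :: "complex set \<Rightarrow> real \<Rightarrow> real" where
  "max_arc W r =
     (SUP E \<in> {E. circle_arc r E \<and> E \<subseteq> W \<inter> sphere 0 r}. angular_measure r E)"

definition limit_arc :: "complex set \<Rightarrow> real" where
  "limit_arc W = Lim at_top (max_arc W)"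

end

theory Submission
  imports Defs "HOL-Real_Asymp.Real_Asymp"
begin

text \<open>The set \<open>W\<close> misses a ray \<open>{s w. s \<ge> 1}\<close> with \<open>w \<noteq> 0\<close>. For large \<open>r\<close> we have
  \<open>2 p A < \<pi>\<close> with \<open>A = max_arc W r\<close>, and radial projection sends each component \<open>V\<close> of
  \<open>W \<inter> {|z| > r}\<close> into an arc of \<open>W \<inter> {|z| = r}\<close>. So \<open>V\<close> lies in a sector of opening at most \<open>A\<close>, and
  the Phragmen-Lindelof principle with \<open>exp (- \<epsilon> (e\<^sup>-\<^sup>i\<^sup>\<theta> z)\<^sup>q)\<close>, \<open>2 p < q < \<pi> / A\<close>, shows that \<open>f\<close> is
  bounded on \<open>V\<close> by a constant that does not depend on \<open>V\<close>. A second application to the bounded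
  function \<open>f\<close>, now with \<open>exp (- \<epsilon> (1 - z / w)\<^sup>1\<^sup>/\<^sup>4)\<close> on all of \<open>W\<close>, improves the bound to \<open>K\<close>.\<close>

section \<open>Maximum modulus and Phragmen-Lindelof on unbounded open sets\<close>

text \<open>No connectedness is needed: a superlevel set \<open>{|f| \<ge> k}\<close> with \<open>k > K\<close> is compact in \<open>U\<close>, and
  \<open>|f| = k\<close> on its frontier.\<close>

lemma maximum_modulus_unbounded:
  fixes f :: "complex \<Rightarrow> complex"
  assumes "open U" and hol: "f holomorphic_on U"
    and bdry: "\<And>\<zeta> k. \<zeta> \<in> frontier U \<Longrightarrow> K < k \<Longrightarrow> \<forall>\<^sub>F z in at \<zeta> within U. cmod (f z) < k"
    and infty: "\<And>k. K < k \<Longrightarrow> \<forall>\<^sub>F z in inf at_infinity (principal U). cmod (f z) < k"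
    and "z \<in> U"
  shows "cmod (f z) \<le> K"
proof (rule ccontr)
  assume "\<not> cmod (f z) \<le> K"
  then obtain k where k: "K < k" "k < cmod (f z)"
    using dense[of K "cmod (f z)"] by auto
  define S where "S = {z \<in> U. k \<le> cmod (f z)}"
  have cont: "continuous_on U f"
    using hol by (rule holomorphic_on_imp_continuous_on)
  have "closed S"
    unfolding closed_limpt
  proof (intro allI impI)
    fix \<zeta> assume lim: "\<zeta> islimpt S"
    then have nt: "at \<zeta> within S \<noteq> bot"
      by (simp add: trivial_limit_within)
    have inS: "\<forall>\<^sub>F z in at \<zeta> within S. z \<in> S"
      by (simp add: eventually_at_filter)
    have SU: "S \<subseteq> U" by (auto simp: S_def)
    show "\<zeta> \<in> S"
    proof (cases "\<zeta> \<in> U")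
      case True
      have "(f \<longlongrightarrow> f \<zeta>) (at \<zeta> within S)"
        using cont True SU unfolding continuous_on_def by (blast intro: tendsto_within_subset)
      moreover have "\<forall>\<^sub>F z in at \<zeta> within S. k \<le> cmod (f z)"
        using inS by eventually_elim (simp add: S_def)
      ultimately have "k \<le> cmod (f \<zeta>)"
        using nt by (intro tendsto_lowerbound[OF tendsto_norm])
      then show ?thesis using True by (simp add: S_def)
    next
      case False
      have "\<zeta> \<in> closure U"
        using islimpt_subset[OF lim SU] by (simp add: closure_def)
      then have "\<zeta> \<in> frontier U"
        using False \<open>open U\<close> by (simp add: frontier_def interior_open)
      then have "\<forall>\<^sub>F z in at \<zeta> within S. cmod (f z) < k"
        using bdry[OF _ k(1)] filter_leD[OF at_le[OF SU]] by blast
      with inS have "\<forall>\<^sub>F z in at \<zeta> within S. False"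
        by eventually_elim (simp add: S_def)
      then show ?thesis using nt by simp
    qed
  qed
  moreover have "bounded S"
  proof -
    obtain b where b: "\<And>z. b \<le> cmod z \<Longrightarrow> z \<in> U \<Longrightarrow> cmod (f z) < k"
      using infty[OF k(1)] by (auto simp: eventually_inf_principal eventually_at_infinity)
    have "S \<subseteq> cball 0 b"
    proof
      fix z assume "z \<in> S"
      then show "z \<in> cball 0 b"
        using b[of z] by (force simp: S_def)
    qed
    then show ?thesis using bounded_cball bounded_subset by blast
  qed
  moreover have "f holomorphic_on interior S"
    by (rule holomorphic_on_subset[OF hol]) (use interior_subset in \<open>force simp: S_def\<close>)
  moreover have "continuous_on S f"
    by (rule continuous_on_subset[OF cont]) (auto simp: S_def)
  moreover have "cmod (f y) \<le> k" if "y \<in> frontier S" for y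
  proof (rule ccontr)
    assume "\<not> cmod (f y) \<le> k"
    moreover have "y \<in> S"
      using that \<open>closed S\<close> frontier_subset_closed by blast
    moreover have "open {z \<in> U. cmod (f z) \<in> {k<..}}"
    proof -
      have "open (U \<inter> (\<lambda>z. cmod (f z)) -` {k<..})"
        by (intro continuous_open_preimage continuous_on_norm cont \<open>open U\<close> open_greaterThan)
      then show ?thesis by (simp add: Int_def vimage_def)
    qed
    ultimately have "y \<in> interior S"
      by (intro interiorI[of "{z \<in> U. cmod (f z) \<in> {k<..}}"]) (auto simp: S_def)
    with that show False by (simp add: frontier_def)
  qed
  moreover have "z \<in> S" using \<open>z \<in> U\<close> k by (simp add: S_def)
  ultimately have "cmod (f z) \<le> k"
    by (intro maximum_modulus_frontier[of f S k z]) auto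
  with k show False by simp
qed

text \<open>Multiplying \<open>f\<close> by \<open>exp (- \<epsilon> * h)\<close> does not increase
  its modulus, since \<open>Re h\<close> is nonnegative, so the boundary bound survives, while the
  damping forces decay at infinity. The maximum modulus principle bounds the product by
  \<open>K\<close>, and \<epsilon> tends to 0 at a fixed point.\<close>

lemma phragmen_lindelof:
  fixes f h :: "complex \<Rightarrow> complex"
  assumes "open U" and hol: "f holomorphic_on U" "h holomorphic_on U"
    and Re_h: "\<And>z. z \<in> U \<Longrightarrow> 0 \<le> Re (h z)" and "0 \<le> K"
    and bdry: "\<And>\<zeta> k. \<zeta> \<in> frontier U \<Longrightarrow> K < k \<Longrightarrow> \<forall>\<^sub>F z in at \<zeta> within U. cmod (f z) < k"
    and infty: "\<And>\<epsilon>. 0 < \<epsilon> \<Longrightarrow>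
      ((\<lambda>z. cmod (f z) * exp (- \<epsilon> * Re (h z))) \<longlongrightarrow> 0) (inf at_infinity (principal U))"
    and "z \<in> U"
  shows "cmod (f z) \<le> K"
proof -
  have damped: "cmod (f z) * exp (- \<epsilon> * Re (h z)) \<le> K" if "0 < \<epsilon>" for \<epsilon>
  proof -
    define g where "g = (\<lambda>z. f z * exp (- of_real \<epsilon> * h z))"
    have norm_g: "cmod (g z) = cmod (f z) * exp (- \<epsilon> * Re (h z))" for z
      by (simp add: g_def norm_mult)
    have "cmod (g z) \<le> K"
    proof (rule maximum_modulus_unbounded[OF \<open>open U\<close> _ _ _ \<open>z \<in> U\<close>])
      show "g holomorphic_on U"
        unfolding g_def using hol by (intro holomorphic_intros)
    next
      fix \<zeta> k assume "\<zeta> \<in> frontier U" "K < k"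
      then have "\<forall>\<^sub>F z in at \<zeta> within U. cmod (f z) < k" by (rule bdry)
      moreover have "\<forall>\<^sub>F z in at \<zeta> within U. z \<in> U"
        by (simp add: eventually_at_filter)
      ultimately show "\<forall>\<^sub>F z in at \<zeta> within U. cmod (g z) < k"
      proof eventually_elim
        case (elim z)
        have "cmod (g z) \<le> cmod (f z) * 1"
          unfolding norm_g using Re_h[OF elim(2)] \<open>0 < \<epsilon>\<close> by (intro mult_left_mono) auto
        with elim show ?case by simp
      qed
    next
      fix k assume "K < k"
      then show "\<forall>\<^sub>F z in inf at_infinity (principal U). cmod (g z) < k"
        using order_tendstoD(2)[OF infty[OF that], of k] \<open>0 \<le> K\<close> by (simp add: norm_g)
    qed
    then show ?thesis by (simp add: norm_g)
  qed
  have "((\<lambda>\<epsilon>. cmod (f z) * exp (- \<epsilon> * Re (h z))) \<longlongrightarrow> cmod (f z) * exp (- 0 * Re (h z)))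
      (at_right 0)"
    by (intro tendsto_intros)
  moreover have "\<forall>\<^sub>F \<epsilon> in at_right 0. cmod (f z) * exp (- \<epsilon> * Re (h z)) \<le> K"
    using eventually_at_right_less by (rule eventually_mono) (rule damped)
  ultimately have "cmod (f z) * exp (- 0 * Re (h z)) \<le> K"
    by (rule tendsto_upperbound) simp
  then show ?thesis by simp
qed

section \<open>Angular measure and maximal arcs\<close>

lemma lmeasurable_Ico: "{a..<b::real} \<in> lmeasurable"
  by (rule bounded_set_imp_lmeasurable) auto

lemma angular_measure_le: "angular_measure r E \<le> 2 * pi"
proof -
  let ?A = "{t \<in> {0..<2 * pi}. rcis r t \<in> E}"
  have "measure lebesgue ?A \<le> 2 * pi"
  \<comment> \<open>\<open>E\<close> is arbitrary here; on a non-measurable set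
    \<open>measure\<close> takes the default value 0.\<close>
  proof (cases "?A \<in> sets lebesgue")
    case True
    then have "measure lebesgue ?A \<le> measure lebesgue {0..<2 * pi}"
      by (intro measure_mono_fmeasurable lmeasurable_Ico) auto
    then show ?thesis by simp
  qed (simp add: measure_notin_sets)
  then show ?thesis by (simp add: angular_measure_def)
qed

lemma bdd_above_angular_measure: "bdd_above (angular_measure r ` \<E>)"
  by (rule bdd_aboveI2[of _ _ "2 * pi"]) (rule angular_measure_le)

lemma angular_measure_le_max_arc:
  assumes "circle_arc r E" "E \<subseteq> W \<inter> sphere 0 r"
  shows "angular_measure r E \<le> max_arc W r"
  unfolding max_arc_def using assms by (intro cSUP_upper bdd_above_angular_measure) auto

lemma circle_arc_empty [simp]: "circle_arc r {}"
  unfolding circle_arc_def by (rule exI[of _ "{}"]) (auto simp: is_interval_def)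

lemma max_arc_nonneg: "0 \<le> max_arc W r"
  using angular_measure_le_max_arc[of r "{}" W] by (simp add: angular_measure_def)

lemma rcis_in_star_like:
  assumes "star_like_with_center 0 W" "rcis s t \<in> W" "0 < r" "r \<le> s"
  shows "rcis r t \<in> W"
proof -
  have "rcis r t = 0 + complex_of_real (r / s) * (rcis s t - 0)"
    using assms by (simp add: rcis_def)
  moreover have "r / s \<in> {0<..1}" using assms by simp
  ultimately show ?thesis
    using assms(1,2) unfolding star_like_with_center_def by blast
qed

text \<open>Radial contraction carries an arc in \<open>W\<close> on the larger circle to one in
  \<open>W\<close> on the smaller circle, with the same set of angles because both radii are
  nonzero.\<close>

lemma max_arc_antimono:
  assumes "star_like_with_center 0 W" "0 < r" "r \<le> s"
  shows "max_arc W s \<le> max_arc W r"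
  unfolding max_arc_def[of W s]
proof (rule cSUP_least)
  show "{E. circle_arc s E \<and> E \<subseteq> W \<inter> sphere 0 s} \<noteq> {}"
    using circle_arc_empty by blast
next
  fix E assume "E \<in> {E. circle_arc s E \<and> E \<subseteq> W \<inter> sphere 0 s}"
  then obtain I where I: "is_interval I" "E = rcis s ` I" "E \<subseteq> W"
    by (auto simp: circle_arc_def)
  have "angular_measure s E = angular_measure r (rcis r ` I)"
    using assms(2,3) by (simp add: angular_measure_def I(2) image_iff rcis_def)
  also have "\<dots> \<le> max_arc W r"
    using I assms by (intro angular_measure_le_max_arc)
      (auto simp: circle_arc_def intro: rcis_in_star_like)
  finally show "angular_measure s E \<le> max_arc W r" .
qed

text \<open>\<open>Lim\<close> carries information only once convergence is known. It holds by
  monotonicity and the lower bound 0, with the infimum over positive radii as limit.\<close>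

lemma max_arc_tendsto:
  assumes "star_like_with_center 0 W"
  shows "(max_arc W \<longlongrightarrow> limit_arc W) at_top"
proof -
  define L where "L = (INF r\<in>{0<..}. max_arc W r)"
  have bdd: "bdd_below (max_arc W ` A)" for A
    by (rule bdd_belowI2[of _ 0]) (rule max_arc_nonneg)
  have "(max_arc W \<longlongrightarrow> L) at_top"
  proof (rule decreasing_tendsto)
    show "\<forall>\<^sub>F r in at_top. L \<le> max_arc W r"
      using eventually_gt_at_top[of 0]
      by eventually_elim (auto simp: L_def intro!: cINF_lower bdd)
  next
    fix x assume "L < x"
    then obtain r where r: "0 < r" "max_arc W r < x"
      unfolding L_def using bdd by (subst (asm) cINF_less_iff) auto
    show "\<forall>\<^sub>F s in at_top. max_arc W s < x"
      using eventually_ge_at_top[of r]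
      by eventually_elim (use max_arc_antimono[OF assms r(1)] r(2) in force)
  qed
  then show ?thesis
    unfolding limit_arc_def using tendsto_Lim[of at_top "max_arc W"] by (simp add: trivial_limit_at_top_linorder)
qed

text \<open>Shifted by a multiple of \<open>2 * pi\<close>, the interval starts in
  \<open>{0..<2 * pi}\<close>. It may still run past \<open>2 * pi\<close>; then it splits into two
  pieces, which are disjoint because its length is below a full turn.\<close>

lemma angular_measure_arc_ge:
  assumes "a \<le> b" "b - a < 2 * pi"
  shows "b - a \<le> angular_measure r (rcis r ` {a..b})"
proof -
  let ?E = "rcis r ` {a..b}"
  let ?A = "{t \<in> {0..<2 * pi}. rcis r t \<in> ?E}"
  define k where "k = \<lfloor>a / (2 * pi)\<rfloor>"
  define c where "c = a - 2 * pi * of_int k"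
  define d where "d = b - 2 * pi * of_int k"
  have c: "0 \<le> c" "c < 2 * pi"
    using floor_divide_lower[of "2 * pi" a] floor_divide_upper[of "2 * pi" a]
    unfolding k_def c_def by (simp_all add: algebra_simps)
  have period: "rcis r (t + 2 * pi * of_int m) = rcis r t" for t m
    by (simp add: rcis_def cis_mult[symmetric] cis_multiple_2pi)
  have mem: "rcis r t \<in> ?E" if "c \<le> t + 2 * pi * of_int m" "t + 2 * pi * of_int m \<le> d" for t m
  proof
    show "rcis r t = rcis r (t + 2 * pi * of_int (m + k))"
      by (rule period[symmetric])
    show "t + 2 * pi * of_int (m + k) \<in> {a..b}"
      using that by (simp add: c_def d_def algebra_simps)
  qed
  \<comment> \<open>Closedness of the preimage makes the set of angles measurable, as monotonicity
    of the measure requires.\<close>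
  have "compact ?E"
    by (intro compact_continuous_image) (auto simp: rcis_def intro!: continuous_intros)
  then have "closed ((\<lambda>t. rcis r t) -` ?E)"
    by (intro closed_vimage compact_imp_closed) (auto simp: rcis_def intro!: continuous_intros)
  then have "{0..<2 * pi} \<inter> rcis r -` ?E \<in> lmeasurable"
    by (intro fmeasurable_Int_fmeasurable lmeasurable_Ico) simp
  moreover have "?A = {0..<2 * pi} \<inter> rcis r -` ?E" by blast
  ultimately have lm: "?A \<in> lmeasurable" by simp
  have "d - c \<le> measure lebesgue ?A"
  proof (cases "d < 2 * pi")
    case True
    have "{c..d} \<subseteq> ?A"
    proof
      fix t assume "t \<in> {c..d}"
      then show "t \<in> ?A" using mem[of t 0] True c by simp
    qed
    then have "measure lebesgue {c..d} \<le> measure lebesgue ?A"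
      by (intro measure_mono_fmeasurable lm) simp_all
    then show ?thesis using assms by (simp add: c_def d_def)
  next
    case False
    have d: "d < c + 2 * pi" using assms by (simp add: c_def d_def)
    \<comment> \<open>The second piece is the part beyond \<open>2 * pi\<close>, moved back by one
      turn; hence \<open>m = 1\<close> there.\<close>
    have "{c..<2 * pi} \<union> {0..d - 2 * pi} \<subseteq> ?A"
    proof
      fix t assume t: "t \<in> {c..<2 * pi} \<union> {0..d - 2 * pi}"
      then show "t \<in> ?A"
      proof
        assume "t \<in> {c..<2 * pi}"
        then show ?thesis using mem[of t 0] False c by simp
      next
        assume "t \<in> {0..d - 2 * pi}"
        then show ?thesis using mem[of t 1] c d by simp
      qed
    qed
    then have "measure lebesgue ({c..<2 * pi} \<union> {0..d - 2 * pi}) \<le> measure lebesgue ?A"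
      by (intro measure_mono_fmeasurable lm) simp_all
    moreover have "measure lebesgue ({c..<2 * pi} \<union> {0..d - 2 * pi})
        = measure lebesgue {c..<2 * pi} + measure lebesgue {0..d - 2 * pi}"
    proof -
      have "{c..<2 * pi} \<inter> {0..d - 2 * pi} = {}" using d by auto
      then show ?thesis by (simp add: measure_Un3 lmeasurable_Ico)
    qed
    ultimately show ?thesis using False c by simp
  qed
  then show ?thesis by (simp add: angular_measure_def c_def d_def)
qed

section \<open>A logarithm cut along a ray, and the angular width of components\<close>

text \<open>A branch of the logarithm whose cut is the ray from \<open>0\<close> through \<open>w\<close>.\<close>

definition log_off :: "complex \<Rightarrow> complex \<Rightarrow> complex" where
  "log_off w z = Ln (- z / w) + Ln (- w)"

lemma
  assumes "z \<noteq> 0" "w \<noteq> 0"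
  shows rcis_Im_log_off: "rcis (cmod z) (Im (log_off w z)) = z"
    and Re_log_off: "Re (log_off w z) = ln (cmod z)"
proof -
  have *: "exp (log_off w z) = z"
    using assms by (simp add: log_off_def exp_add)
  have **: "cmod z = exp (Re (log_off w z))"
    by (subst *[symmetric]) (rule norm_exp_eq_Re)
  show "rcis (cmod z) (Im (log_off w z)) = z"
    by (subst **, subst (3) *[symmetric]) (simp only: rcis_def exp_eq_polar)
  show "Re (log_off w z) = ln (cmod z)"
    by (simp add: **)
qed

text \<open>The term \<open>Ln (- w)\<close> cancels, and imaginary parts of \<open>Ln\<close> lie
  in a half-open interval of length \<open>2 * pi\<close>; this makes the inequality strict.\<close>

lemma Im_log_off_diff_less:
  assumes "z \<noteq> 0" "z' \<noteq> 0" "w \<noteq> 0"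
  shows "Im (log_off w z) - Im (log_off w z') < 2 * pi"
  using Im_Ln_le_pi[of "- z / w"] mpi_less_Im_Ln[of "- z' / w"] assms by (simp add: log_off_def)

lemma holomorphic_log_off:
  assumes "w \<noteq> 0" "\<And>z s. z \<in> V \<Longrightarrow> 0 \<le> s \<Longrightarrow> z \<noteq> of_real s * w"
  shows "log_off w holomorphic_on V"
proof -
  have "- z / w \<notin> \<real>\<^sub>\<le>\<^sub>0" if "z \<in> V" for z
  proof
    assume "- z / w \<in> \<real>\<^sub>\<le>\<^sub>0"
    then obtain s where "- z / w = of_real s" "s \<le> 0"
      by (rule nonpos_Reals_cases)
    then have "- z = of_real s * w" "0 \<le> - s"
      using assms(1) by (auto simp: field_simps)
    then have "z = of_real (- s) * w" by (metis minus_minus minus_mult_left of_real_minus)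
    then show False using assms(2)[OF that \<open>0 \<le> - s\<close>] by blast
  qed
  then have "(\<lambda>z. Ln (- z / w) + Ln (- w)) holomorphic_on V"
    using assms(1) by (intro holomorphic_intros) auto
  then show ?thesis by (simp add: log_off_def[abs_def])
qed

lemma star_like_avoids_ray:
  assumes "star_like_with_center 0 W" "w \<notin> W" "1 \<le> s"
  shows "of_real s * w \<notin> W"
proof
  assume "of_real s * w \<in> W"
  moreover have "w = 0 + complex_of_real (1 / s) * (of_real s * w - 0)" "1 / s \<in> {0<..1}"
    using assms(3) by auto
  ultimately show False
    using assms(1,2) unfolding star_like_with_center_def by blast
qed

text \<open>The cut misses \<open>V\<close>: its part up to \<open>w\<close> lies in the removed
  disc, and its part from \<open>w\<close> on lies outside \<open>W\<close> by
  star-likeness.\<close>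

lemma holomorphic_log_off_star_like:
  assumes "star_like_with_center 0 W" "w \<notin> W" "w \<noteq> 0" "cmod w \<le> r" "V \<subseteq> W - cball 0 r"
  shows "log_off w holomorphic_on V"
proof (rule holomorphic_log_off[OF \<open>w \<noteq> 0\<close>])
  fix z and s :: real assume z: "z \<in> V" "0 \<le> s"
  show "z \<noteq> of_real s * w"
  proof
    assume eq: "z = of_real s * w"
    have "1 \<le> s"
    proof (rule ccontr)
      assume "\<not> 1 \<le> s"
      then have "s * cmod w \<le> 1 * cmod w" by (intro mult_right_mono) auto
      then show False using z assms(4,5) by (auto simp: eq norm_mult)
    qed
    then show False
      using star_like_avoids_ray[OF assms(1,2)] z(1) assms(5) eq by blast
  qed
qed

text \<open>By connectedness every angle between those of \<open>z1\<close> and \<open>z2\<close> is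
  attained in \<open>V\<close>. Contracting these points radially to the circle of radius
  \<open>r\<close> gives an arc inside \<open>W\<close>.\<close>

lemma Im_log_off_diff_le_max_arc:
  assumes star: "star_like_with_center 0 W" and w: "w \<notin> W" "w \<noteq> 0" "cmod w \<le> r"
    and V: "connected V" "V \<subseteq> W - cball 0 r" and z: "z1 \<in> V" "z2 \<in> V"
  shows "Im (log_off w z2) - Im (log_off w z1) \<le> max_arc W r"
proof (cases "Im (log_off w z1) \<le> Im (log_off w z2)")
  case True
  define a b where "a = Im (log_off w z1)" and "b = Im (log_off w z2)"
  have r: "0 < r" using w by (meson less_le_trans zero_less_norm_iff)
  have outside: "z \<in> W" "r < cmod z" "z \<noteq> 0" if "z \<in> V" for z
    using that V(2) r by auto
  have "continuous_on V (\<lambda>z. Im (log_off w z))"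
    by (intro continuous_intros holomorphic_on_imp_continuous_on
        holomorphic_log_off_star_like[OF star w V(2)])
  then have "connected ((\<lambda>z. Im (log_off w z)) ` V)"
    using V(1) by (rule connected_continuous_image)
  then have sub: "{a..b} \<subseteq> (\<lambda>z. Im (log_off w z)) ` V"
    using z unfolding a_def b_def by (intro connected_contains_Icc) auto
  have "rcis r t \<in> W" if t: "t \<in> {a..b}" for t
  proof -
    obtain z where "z \<in> V" "t = Im (log_off w z)" using sub t by blast
    then have "rcis (cmod z) t \<in> W" "r \<le> cmod z"
      using rcis_Im_log_off[of z w] outside[of z] w(2) by auto
    then show ?thesis using rcis_in_star_like[OF star] r by blast
  qed
  then have "rcis r ` {a..b} \<subseteq> W \<inter> sphere 0 r" using r by auto
  moreover have "circle_arc r (rcis r ` {a..b})"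
    unfolding circle_arc_def using is_interval_cc by blast
  ultimately have "angular_measure r (rcis r ` {a..b}) \<le> max_arc W r"
    by (intro angular_measure_le_max_arc)
  moreover have "b - a < 2 * pi"
    unfolding a_def b_def by (intro Im_log_off_diff_less outside(3) z w(2))
  then have "b - a \<le> angular_measure r (rcis r ` {a..b})"
    using True by (intro angular_measure_arc_ge) (simp_all add: a_def b_def)
  ultimately show ?thesis by (simp add: a_def b_def)
next
  case False
  then show ?thesis using max_arc_nonneg[of W r] by simp
qed

section \<open>Damping beats growth of smaller order\<close>

lemma damped_growth_tendsto_0:
  fixes s q c C :: real
  assumes "0 < s" "s < q" "0 < c"
  shows "((\<lambda>x. (C * exp (C * x powr s) + C) * exp (- c * x powr q)) \<longlongrightarrow> 0) at_top"
proof -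
  \<comment> \<open>Factoring \<open>x powr q\<close> out of the exponent leaves a factor with the
    negative limit \<open>- c\<close>.\<close>
  have "((\<lambda>x. C * x powr (s - q) - c) \<longlongrightarrow> C * 0 - c) at_top"
    using assms by (intro tendsto_intros tendsto_neg_powr filterlim_ident) auto
  then have "filterlim (\<lambda>x. (C * x powr (s - q) - c) * x powr q) at_bot at_top"
    using assms by (intro filterlim_tendsto_neg_mult_at_bot[of _ "- c"]) (simp, simp, real_asymp)
  then have "filterlim (\<lambda>x. C * x powr s - c * x powr q) at_bot at_top"
    by (simp add: algebra_simps flip: powr_add)
  then have 1: "((\<lambda>x. exp (C * x powr s - c * x powr q)) \<longlongrightarrow> 0) at_top"
    by (rule filterlim_compose[OF exp_at_bot])
  have "((\<lambda>x::real. exp (- c * x powr q)) \<longlongrightarrow> 0) at_top"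
    using assms by real_asymp
  with 1 have "((\<lambda>x. C * exp (C * x powr s - c * x powr q) + C * exp (- c * x powr q))
      \<longlongrightarrow> C * 0 + C * 0) at_top"
    by (intro tendsto_intros)
  then show ?thesis by (simp add: algebra_simps exp_diff exp_minus field_simps)
qed

lemma damped_tendsto_0:
  fixes f h :: "complex \<Rightarrow> complex"
  assumes "0 < s" "s < q" "0 < c" "0 < \<epsilon>"
    and f: "\<forall>z\<in>U. cmod (f z) \<le> C * exp (C * cmod z powr s) + C"
    and h: "\<forall>\<^sub>F z in inf at_infinity (principal U). c * cmod z powr q \<le> Re (h z)"
  shows "((\<lambda>z. cmod (f z) * exp (- \<epsilon> * Re (h z))) \<longlongrightarrow> 0) (inf at_infinity (principal U))"
proof (rule tendsto_sandwich[OF _ _ tendsto_const])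
  have "filterlim cmod at_top (inf at_infinity (principal U))"
    by (rule filterlim_mono[OF filterlim_norm_at_top]) auto
  then show "((\<lambda>z. (C * exp (C * cmod z powr s) + C) * exp (- (\<epsilon> * c) * cmod z powr q)) \<longlongrightarrow> 0)
      (inf at_infinity (principal U))"
    using assms by (intro filterlim_compose[OF damped_growth_tendsto_0]) simp_all
  have "\<forall>\<^sub>F z in inf at_infinity (principal U). z \<in> U"
    by (simp add: eventually_inf_principal)
  with h show "\<forall>\<^sub>F z in inf at_infinity (principal U). cmod (f z) * exp (- \<epsilon> * Re (h z))
      \<le> (C * exp (C * cmod z powr s) + C) * exp (- (\<epsilon> * c) * cmod z powr q)"
  proof eventually_elim
    case (elim z)
    then have "cmod (f z) \<le> C * exp (C * cmod z powr s) + C" using f by blast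
    moreover have "\<epsilon> * (c * cmod z powr q) \<le> \<epsilon> * Re (h z)"
      using elim assms(4) by (intro mult_left_mono) auto
    then have "exp (- \<epsilon> * Re (h z)) \<le> exp (- (\<epsilon> * c) * cmod z powr q)" by simp
    ultimately show ?case
      by (intro mult_mono) (auto intro: order_trans[OF norm_ge_zero])
  qed
qed simp

section \<open>The two applications of Phragmen-Lindelof\<close>

lemma bounded_outside_disc:
  fixes f :: "complex \<Rightarrow> complex"
  assumes "open W" and star: "star_like_with_center 0 W"
    and w: "w \<notin> W" "w \<noteq> 0" "cmod w \<le> r"
    and hol: "f holomorphic_on W"
    and bdry: "\<And>\<zeta> k. \<zeta> \<in> frontier W \<Longrightarrow> K < k \<Longrightarrow> \<forall>\<^sub>F z in at \<zeta> within W. cmod (f z) < k"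
    and p: "0 < p" "2 * p * max_arc W r < pi" and "0 < C"
    and growth: "\<forall>z\<in>W. cmod (f z) \<le> C * exp (C * cmod z powr (2 * p)) + C"
    and M: "K \<le> M" "C * exp (C * r powr (2 * p)) + C \<le> M"
    and z0: "z0 \<in> W" "r < cmod z0"
  shows "cmod (f z0) \<le> M"
proof -
  define A where "A = max_arc W r"
  have A: "0 \<le> A" "2 * p * A < pi" using p max_arc_nonneg by (auto simp: A_def)
  \<comment> \<open>An exponent above the growth order \<open>2 * p\<close> but small enough for the
    sector; for \<open>A = 0\<close> there is no upper constraint.\<close>
  obtain q where q: "2 * p < q" "q * A < pi"
  proof (cases "A = 0")
    case True
    then show thesis using that[of "2 * p + 1"] by simp
  next
    case False
    then show thesis
      using that dense[of "2 * p" "pi / A"] A by (auto simp: field_simps)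
  qed
  define U where "U = W - cball 0 r"
  define V where "V = connected_component_set U z0"
  have "open U" unfolding U_def using \<open>open W\<close> by (intro open_Diff) auto
  then have "open V" unfolding V_def by (rule open_connected_component)
  have "connected V" unfolding V_def by simp
  have VU: "V \<subseteq> W - cball 0 r"
    unfolding V_def using connected_component_subset by (auto simp: U_def)
  then have VW: "V \<subseteq> W" by blast
  have "z0 \<in> V" using z0 by (simp add: V_def U_def connected_component_refl_eq)
  have r: "0 < r" using w by (meson less_le_trans zero_less_norm_iff)
  define I where "I = (\<lambda>z. Im (log_off w z)) ` V"
  have diam: "t - t' \<le> A" if "t \<in> I" "t' \<in> I" for t t'
    using that Im_log_off_diff_le_max_arc[OF star w \<open>connected V\<close> VU] by (auto simp: I_def A_def)
  have "I \<noteq> {}" using \<open>z0 \<in> V\<close> by (auto simp: I_def)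
  then obtain t0 where "t0 \<in> I" by blast
  have bdd: "bdd_above I" "bdd_below I"
    using diam[OF _ \<open>t0 \<in> I\<close>] diam[OF \<open>t0 \<in> I\<close>]
    by (auto simp: algebra_simps intro!: bdd_aboveI[of _ "t0 + A"] bdd_belowI[of _ "t0 - A"])
  have "t - A \<le> Inf I" if "t \<in> I" for t
    using diam[OF that] \<open>I \<noteq> {}\<close> by (intro cInf_greatest) (auto simp: algebra_simps)
  then have "Sup I \<le> Inf I + A"
    using \<open>I \<noteq> {}\<close> by (intro cSup_least) (auto simp: algebra_simps)
  \<comment> \<open>The middle of the range of angles, so that each angle on \<open>V\<close>
    deviates from it by at most \<open>A / 2\<close>.\<close>
  define \<theta> where "\<theta> = (Inf I + Sup I) / 2"
  have \<theta>: "\<bar>t - \<theta>\<bar> \<le> A / 2" if "t \<in> I" for t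
    using cInf_lower[OF that bdd(2)] cSup_upper[OF that bdd(1)] \<open>Sup I \<le> Inf I + A\<close>
    unfolding \<theta>_def by argo
  \<comment> \<open>Positive since \<open>q * A / 2 < pi / 2\<close>; it is a lower bound for the
    cosine in \<open>Re (h z)\<close>.\<close>
  define c where "c = cos (q * A / 2)"
  have "0 < q" using p q by simp
  have "0 \<le> q * A" using \<open>0 < q\<close> A by simp
  then have "0 < c" unfolding c_def using q pi_gt_zero by (intro cos_gt_zero_pi) linarith+
  define h where "h = (\<lambda>z. exp (of_real q * (log_off w z - \<i> * of_real \<theta>)))"
  have Re_h: "c * cmod z powr q \<le> Re (h z)" if "z \<in> V" for z
  proof -
    define x where "x = q * (Im (log_off w z) - \<theta>)"
    have z: "z \<noteq> 0" using that VU r by auto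
    have "\<bar>x\<bar> = q * \<bar>Im (log_off w z) - \<theta>\<bar>"
      using \<open>0 < q\<close> by (simp add: x_def abs_mult)
    also have "\<dots> \<le> q * (A / 2)"
      using that \<open>0 < q\<close> by (intro mult_left_mono \<theta>) (auto simp: I_def)
    finally have "\<bar>x\<bar> \<le> q * A / 2" by simp
    then have "c \<le> cos \<bar>x\<bar>"
      unfolding c_def using q A by (intro cos_monotone_0_pi_le) auto
    then have "c \<le> cos x" by simp
    moreover have "Re (h z) = cmod z powr q * cos x"
      using Re_log_off[OF z w(2)] z by (simp add: h_def Re_exp x_def powr_def)
    ultimately show ?thesis
      by (simp add: mult_right_mono mult.commute[of _ "cos x"])
  qed
  show ?thesis
  proof (rule phragmen_lindelof[OF \<open>open V\<close> _ _ _ _ _ _ \<open>z0 \<in> V\<close>])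
    show "f holomorphic_on V" using hol VW by (rule holomorphic_on_subset)
    show "h holomorphic_on V"
      unfolding h_def by (intro holomorphic_intros holomorphic_log_off_star_like[OF star w VU])
    show "0 \<le> Re (h z)" if "z \<in> V" for z
      using \<open>0 < c\<close> by (intro order_trans[OF _ Re_h[OF that]]) simp
    have "0 < C * exp (C * r powr (2 * p)) + C"
      using \<open>0 < C\<close> by (intro add_pos_pos mult_pos_pos) auto
    then show "0 \<le> M" using M(2) by simp
  next
    fix \<epsilon> :: real assume "0 < \<epsilon>"
    show "((\<lambda>z. cmod (f z) * exp (- \<epsilon> * Re (h z))) \<longlongrightarrow> 0) (inf at_infinity (principal V))"
    proof (rule damped_tendsto_0)
      show "\<forall>z\<in>V. cmod (f z) \<le> C * exp (C * cmod z powr (2 * p)) + C"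
        using growth VW by blast
      show "\<forall>\<^sub>F z in inf at_infinity (principal V). c * cmod z powr q \<le> Re (h z)"
        using Re_h by (simp add: eventually_inf_principal)
    qed (use p q \<open>0 < c\<close> \<open>0 < \<epsilon>\<close> in auto)
  next
    fix \<zeta> k assume \<zeta>: "\<zeta> \<in> frontier V" and k: "M < k"
    have "\<zeta> \<in> frontier U"
      using \<zeta> frontier_of_connected_component_subset[of U z0] by (auto simp: V_def)
    show "\<forall>\<^sub>F z in at \<zeta> within V. cmod (f z) < k"
    \<comment> \<open>Beyond the circle, a frontier point of the component is a frontier point of
      \<open>W\<close>, where \<open>K\<close> applies. Otherwise the growth bound takes over;
      \<open>M\<close> dominates both.\<close>
    proof (cases "r < cmod \<zeta>")
      case True
      have "\<zeta> \<in> closure W" "\<zeta> \<notin> U"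
        using \<open>\<zeta> \<in> frontier U\<close> \<open>open U\<close> closure_mono[of U W]
        by (auto simp: frontier_def interior_open U_def)
      then have "\<zeta> \<in> frontier W"
        using True \<open>open W\<close> by (auto simp: frontier_def interior_open U_def)
      then have "\<forall>\<^sub>F z in at \<zeta> within W. cmod (f z) < k"
        using k M(1) by (intro bdry) auto
      then show ?thesis using filter_leD[OF at_le[OF VW]] by blast
    next
      case False
      define g where "g = (\<lambda>z. C * exp (C * cmod z powr (2 * p)) + C)"
      have "g \<zeta> \<le> C * exp (C * r powr (2 * p)) + C"
        unfolding g_def using False \<open>0 < C\<close> p r by (auto intro!: mult_left_mono powr_mono2)
      then have "g \<zeta> < k" using M(2) k by simp
      moreover have "(g \<longlongrightarrow> g \<zeta>) (at \<zeta> within V)"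
        unfolding g_def using p
        by (intro tendsto_intros tendsto_powr') auto
      ultimately have "\<forall>\<^sub>F z in at \<zeta> within V. g z < k" by (intro order_tendstoD)
      moreover have "\<forall>\<^sub>F z in at \<zeta> within V. z \<in> V" by (simp add: eventually_at_filter)
      ultimately show ?thesis
      proof eventually_elim
        case (elim z)
        then have "cmod (f z) \<le> g z" using growth VW by (auto simp: g_def)
        with elim show ?case by simp
      qed
    qed
  qed
qed

lemma bounded_off_ray:
  fixes f :: "complex \<Rightarrow> complex"
  assumes "open W" and "w \<noteq> 0" and ray: "\<And>s. 1 \<le> s \<Longrightarrow> of_real s * w \<notin> W"
    and hol: "f holomorphic_on W" and "0 \<le> K"
    and bdry: "\<And>\<zeta> k. \<zeta> \<in> frontier W \<Longrightarrow> K < k \<Longrightarrow> \<forall>\<^sub>F z in at \<zeta> within W. cmod (f z) < k"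
    and bounded: "\<And>z. z \<in> W \<Longrightarrow> cmod (f z) \<le> M" and "z0 \<in> W"
  shows "cmod (f z0) \<le> K"
proof -
  have slit: "1 - z / w \<notin> \<real>\<^sub>\<le>\<^sub>0" if "z \<in> W" for z
  proof
    assume "1 - z / w \<in> \<real>\<^sub>\<le>\<^sub>0"
    then obtain s where "1 - z / w = of_real s" "s \<le> 0"
      by (rule nonpos_Reals_cases)
    then have "z = of_real (1 - s) * w" "1 \<le> 1 - s"
      using \<open>w \<noteq> 0\<close> by (auto simp: field_simps)
    then show False using ray that by blast
  qed
  \<comment> \<open>A fourth root of \<open>1 - z / w\<close>: on the slit plane its argument is at
    most \<open>pi / 4\<close> in modulus. Any positive exponent below \<open>1 / 2\<close> would
    keep the cosine away from 0.\<close>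
  define h where "h = (\<lambda>z. exp (Ln (1 - z / w) / 4))"
  have Re_h: "cos (pi / 4) * cmod (1 - z / w) powr (1 / 4) \<le> Re (h z)" if "z \<in> W" for z
  proof -
    define x where "x = Im (Ln (1 - z / w)) / 4"
    have nz: "1 - z / w \<noteq> 0" using slit[OF that] by auto
    have "\<bar>x\<bar> \<le> pi / 4"
      using Im_Ln_le_pi[OF nz] mpi_less_Im_Ln[OF nz] by (auto simp: x_def)
    then have "cos (pi / 4) \<le> cos \<bar>x\<bar>" by (intro cos_monotone_0_pi_le) auto
    moreover have "Re (h z) = cmod (1 - z / w) powr (1 / 4) * cos x"
      using nz \<open>w \<noteq> 0\<close> by (simp add: h_def Re_exp x_def powr_def)
    ultimately show ?thesis by (simp add: mult_right_mono mult.commute[of _ "cos x"])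
  qed
  have "0 < cos (pi / 4)" by (simp add: cos_45)
  show ?thesis
  proof (rule phragmen_lindelof[OF \<open>open W\<close> hol _ _ \<open>0 \<le> K\<close> bdry _ \<open>z0 \<in> W\<close>])
    show "h holomorphic_on W"
      unfolding h_def using slit \<open>w \<noteq> 0\<close> by (intro holomorphic_intros) auto
    show "0 \<le> Re (h z)" if "z \<in> W" for z
      using \<open>0 < cos (pi / 4)\<close> by (intro order_trans[OF _ Re_h[OF that]]) simp
  next
    fix \<epsilon> :: real assume "0 < \<epsilon>"
    \<comment> \<open>For \<open>cmod z\<close> at least \<open>2 * cmod w\<close>, the modulus of
      \<open>1 - z / w\<close> is at least \<open>cmod z / (2 * cmod w)\<close>.\<close>
    define c where "c = cos (pi / 4) * (1 / (2 * cmod w)) powr (1 / 4)"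
    show "((\<lambda>z. cmod (f z) * exp (- \<epsilon> * Re (h z))) \<longlongrightarrow> 0) (inf at_infinity (principal W))"
    \<comment> \<open>The constant bound \<open>M\<close> is weakened to fit the growth condition;
      \<open>1 / 8\<close> is an arbitrary order below \<open>1 / 4\<close>.\<close>
    proof (rule damped_tendsto_0[where s = "1 / 8" and q = "1 / 4" and c = c and C = M])
      show "0 < c" using \<open>0 < cos (pi / 4)\<close> \<open>w \<noteq> 0\<close> by (simp add: c_def)
      show "\<forall>z\<in>W. cmod (f z) \<le> M * exp (M * cmod z powr (1 / 8)) + M"
      proof
        fix z assume "z \<in> W"
        then have "cmod (f z) \<le> M" by (rule bounded)
        then show "cmod (f z) \<le> M * exp (M * cmod z powr (1 / 8)) + M"
          using order_trans[OF norm_ge_zero \<open>cmod (f z) \<le> M\<close>] by (simp add: add_increasing)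
      qed
      show "\<forall>\<^sub>F z in inf at_infinity (principal W). c * cmod z powr (1 / 4) \<le> Re (h z)"
        unfolding eventually_inf_principal eventually_at_infinity
      proof (intro exI[of _ "2 * cmod w"] allI impI)
        fix z assume z: "2 * cmod w \<le> cmod z" "z \<in> W"
        have "cmod z / (2 * cmod w) \<le> cmod (z / w) - 1"
          using z(1) \<open>w \<noteq> 0\<close> by (simp add: norm_divide field_simps)
        also have "\<dots> \<le> cmod (1 - z / w)"
          using norm_triangle_ineq2[of "z / w" 1] by (simp add: norm_minus_commute)
        finally have "(cmod z / (2 * cmod w)) powr (1 / 4) \<le> cmod (1 - z / w) powr (1 / 4)"
          by (intro powr_mono2) auto
        then have "c * cmod z powr (1 / 4) \<le> cos (pi / 4) * cmod (1 - z / w) powr (1 / 4)"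
          using \<open>0 < cos (pi / 4)\<close> \<open>w \<noteq> 0\<close>
          by (simp add: c_def powr_divide powr_mult cos_45 field_simps)
        then show "c * cmod z powr (1 / 4) \<le> Re (h z)" using Re_h[OF z(2)] by simp
      qed
    qed (use \<open>0 < \<epsilon>\<close> in auto)
  qed
qed

(* W = UNIV and W = - {0} are excluded because the claim fails there: for W = UNIV the boundary
   is empty and f = (\<lambda>_. 2) violates K = 1; for W = - {0} take f z = z, K = 1, p = 1/8.
   The quotient is taken in ereal, where pi / 0 = \<infinity>. *)
theorem corollary3:
  fixes W :: "complex set" and f :: "complex \<Rightarrow> complex" and K C p :: real
  assumes "domain W"
    and "star_like_with_center 0 W"
    and "W \<noteq> UNIV" and "W \<noteq> - {0}"
    and "f analytic_on W"
    and "\<forall>\<zeta>\<in>frontier W. Limsup (at \<zeta> within W) (\<lambda>z. ereal (cmod (f z))) \<le> ereal K"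
    and "C > 0" and "p > 0"
    and "ereal p < ereal pi / (2 * ereal (limit_arc W))"
    and "\<forall>z\<in>W. cmod (f z) \<le> C * exp (C * cmod z powr (2 * p)) + C"
  shows "\<forall>z\<in>W. cmod (f z) \<le> K"
proof
  fix z0 assume "z0 \<in> W"
  have "open W" "W \<noteq> {}" using assms(1) by (auto simp: domain_def)
  have hol: "f holomorphic_on W" using assms(5) by (rule analytic_imp_holomorphic)
  \<comment> \<open>Only the two excluded sets contain the punctured plane, so some nonzero
    \<open>w\<close> lies outside \<open>W\<close>.\<close>
  have "\<not> - {0} \<subseteq> W"
  proof
    assume sub: "- {0} \<subseteq> W"
    show False
    proof (cases "0 \<in> W")
      case True
      then have "insert 0 (- {0}) \<subseteq> W" using sub by (rule insert_subsetI)
      moreover have "insert 0 (- {0 :: complex}) = UNIV" by auto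
      ultimately show False using assms(3) by (simp add: top.extremum_unique)
    next
      case False
      then have "W \<subseteq> - {0}" by auto
      with sub assms(4) show False by (simp add: subset_antisym)
    qed
  qed
  then obtain w where w: "w \<noteq> 0" "w \<notin> W" by auto
  have bdry: "\<forall>\<^sub>F z in at \<zeta> within W. cmod (f z) < k" if "\<zeta> \<in> frontier W" "K < k" for \<zeta> k
  proof -
    have "\<forall>\<^sub>F z in at \<zeta> within W. ereal (cmod (f z)) < ereal k"
      using assms(6) that(1) \<open>K < k\<close> by (metis Limsup_le_iff less_ereal.simps(1))
    then show ?thesis by simp
  qed
  \<comment> \<open>The frontier is nonempty, and a negative \<open>K\<close> would make
    \<open>cmod (f z)\<close> negative near a frontier point.\<close>
  have "0 \<le> K"
  proof (rule ccontr)
    assume "\<not> 0 \<le> K"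
    obtain \<zeta> where \<zeta>: "\<zeta> \<in> frontier W"
      using assms(3) \<open>W \<noteq> {}\<close> frontier_eq_empty by blast
    then have "\<zeta> islimpt W"
      using \<open>open W\<close> by (auto simp: frontier_def interior_open closure_def)
    then have "at \<zeta> within W \<noteq> bot" by (simp add: trivial_limit_within)
    moreover have "\<forall>\<^sub>F z in at \<zeta> within W. cmod (f z) < 0"
      using \<open>\<not> 0 \<le> K\<close> by (intro bdry \<zeta>) simp
    ultimately show False by simp
  qed
  have lim: "(max_arc W \<longlongrightarrow> limit_arc W) at_top"
    by (rule max_arc_tendsto) fact
  then have "0 \<le> limit_arc W"
    by (rule tendsto_lowerbound) (auto simp: max_arc_nonneg)
  \<comment> \<open>For a zero limit this reads \<open>0 < pi\<close>; otherwise the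
    \<open>ereal\<close> quotient is an ordinary real one.\<close>
  have "2 * p * limit_arc W < pi"
  proof (cases "limit_arc W = 0")
    case False
    then show ?thesis
      using assms(9) \<open>0 \<le> limit_arc W\<close> by (simp add: field_simps)
  qed simp
  then have "\<forall>\<^sub>F r in at_top. 2 * p * max_arc W r < pi"
    by (intro order_tendstoD[OF tendsto_mult_left[OF lim]])
  then obtain r where r: "2 * p * max_arc W r < pi" "cmod w \<le> r"
    using eventually_happens'[OF _ eventually_conj[OF _ eventually_ge_at_top[of "cmod w"]]]
    by (metis (no_types, lifting) trivial_limit_at_top_linorder)
  \<comment> \<open>The second entry bounds \<open>f\<close> on the part of \<open>W\<close> in the
    closed disc of radius \<open>r\<close>, so one constant serves inside and outside.\<close>
  define M where "M = max K (C * exp (C * r powr (2 * p)) + C)"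
  have bounded: "cmod (f z) \<le> M" if "z \<in> W" for z
  proof (cases "r < cmod z")
    case True
    show ?thesis
      by (rule bounded_outside_disc[OF \<open>open W\<close> assms(2) w(2,1) r(2) hol bdry \<open>p > 0\<close> r(1)
          \<open>C > 0\<close> assms(10) _ _ that True]) (auto simp: M_def)
  next
    case False
    have "cmod (f z) \<le> C * exp (C * cmod z powr (2 * p)) + C"
      using assms(10) that by blast
    also have "\<dots> \<le> C * exp (C * r powr (2 * p)) + C"
      using False \<open>C > 0\<close> \<open>p > 0\<close> by (auto intro!: mult_left_mono powr_mono2)
    finally show ?thesis by (simp add: M_def)
  qed
  show "cmod (f z0) \<le> K"
    by (rule bounded_off_ray[OF \<open>open W\<close> w(1) star_like_avoids_ray[OF assms(2) w(2)] hol
        \<open>0 \<le> K\<close> bdry bounded \<open>z0 \<in> W\<close>])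
qed

end
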